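(* Let $s>1$ be a natural number. For every function $f\in\Lambda_s$, the Hausdorff--Besicovitch dimension (Hausdorff dimension) of the graph of $f$ is equal to $1$.
   Context: Let $s>1$ be a fixed natural number and $A=\{0,1,\dots,s-1\}$. For digits $\alpha_n\in A$ write $\Delta^{s}_{\alpha_1\alpha_2\dots\alpha_n\dots}=\sum_{n=1}^{\infty}\frac{\alpha_n}{s^n}\in[0,1]$ (s-adic representation) and $\Delta^{-s}_{\alpha_1\alpha_2\dots\alpha_n\dots}=\sum_{n=1}^{\infty}\frac{(-1)^n\alpha_n}{s^n}\in\left[-\frac{s}{s+1},\frac{1}{s+1}\right]$ (nega-s-adic representation). An s-adic rational number is one with two s-adic representations $\Delta^s_{\alpha_1\dots\alpha_{n-1}\alpha_n000\dots}=\Delta^s_{\alpha_1\dots\alpha_{n-1}[\alpha_n-1][s-1][s-1]\dots}$; a nega-s-adic rational number is one with two nega-s-adic representations $\Delta^{-s}_{\alpha_1\dots\alpha_{n-1}\alpha_n[s-1]0[s-1]0\dots}=\Delta^{-s}_{\alpha_1\dots\alpha_{n-1}[\alpha_n-1]0[s-1]0[s-1]\dots}$ ($\alpha_n\neq0$). The class $\Lambda_s$ consists of the functions $f:\ x=\Delta^{\pm s}_{\alpha_1\alpha_2\dots\alpha_n\dots}\mapsto \Delta^{\pm s}_{\beta_1\beta_2\dots\beta_n\dots}=f(x)$ (the argument is represented either s-adically or nega-s-adically, and the value either s-adically or nega-s-adically, these choices being fixed for the given $f$), where $(\beta_{km+1},\dots,\beta_{(m+1)k})=\theta(\alpha_{km+1},\dots,\alpha_{(m+1)k})$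 for $m=0,1,2,\dots$, $k$ is a positive integer fixed for the given $f$, and $\theta:A^k\to A^k$ is a bijection. The domain of $f$ is $[0,1]$ if the argument is represented s-adically and $[-\frac{s}{s+1},\frac{1}{s+1}]$ if it is represented nega-s-adically. Convention (making the functions other than $y=x$, $y=1-x$, $y=-\frac{s-1}{s+1}-x$ well defined): of the two representations of an s-adic rational argument, the one with period $(s-1)$ is not used; of the two representations of a nega-s-adic rational argument, the one with period $(0[s-1])$, i.e. $\Delta^{-s}_{\alpha_1\dots\alpha_{n-1}[\alpha_n-1]0[s-1]0[s-1]\dots}$, is not used. *)

theory Defs
  imports "HOL-Analysis.Analysis"
begin

text \<open>
  The diameter of an unbounded set is an arbitrary real number in the library, so covering sets
  are required to be bounded below. Since \<open>0 powr 0 = 0\<close>, the usual convention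
  \<open>diam(U)^0 = 1\<close> for nonempty \<open>U\<close> is made explicit.
\<close>

definition diam_pow :: "real \<Rightarrow> 'a::metric_space set \<Rightarrow> ennreal" where
  "diam_pow t U = (if U = {} then 0 else if t = 0 then 1 else ennreal (diameter U powr t))"

definition hausdorff_pre_measure :: "real \<Rightarrow> real \<Rightarrow> 'a::metric_space set \<Rightarrow> ennreal" where
  "hausdorff_pre_measure t \<delta> E =
     Inf {\<Sum>n. diam_pow t (U n) | U :: nat \<Rightarrow> 'a set.
            E \<subseteq> (\<Union>n. U n) \<and> (\<forall>n. bounded (U n) \<and> diameter (U n) \<le> \<delta>)}"

definition hausdorff_measure :: "real \<Rightarrow> 'a::metric_space set \<Rightarrow> ennreal" where
  "hausdorff_measure t E = (SUP \<delta>\<in>{0<..}. hausdorff_pre_measure t \<delta> E)"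

definition hausdorff_dim :: "'a::metric_space set \<Rightarrow> ennreal" where
  "hausdorff_dim E = Inf {ennreal t | t. 0 \<le> t \<and> hausdorff_measure t E = 0}"

datatype expansion = Adic | Nega

definition digit_seqs :: "nat \<Rightarrow> (nat \<Rightarrow> nat) set" where
  "digit_seqs s = {\<alpha>. \<forall>n. \<alpha> n < s}"

text \<open>Digit sequences are indexed from \<open>0\<close>: \<open>\<alpha> n\<close> is the digit \<open>\<alpha>\<^sub>n\<^sub>+\<^sub>1\<close> of the expansion.\<close>

fun expansion_val :: "expansion \<Rightarrow> nat \<Rightarrow> (nat \<Rightarrow> nat) \<Rightarrow> real" where
  "expansion_val Adic s \<alpha> = (\<Sum>n. real (\<alpha> n) / real s ^ Suc n)"
| "expansion_val Nega s \<alpha> = (\<Sum>n. (- 1) ^ Suc n * real (\<alpha> n) / real s ^ Suc n)"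

fun expansion_dom :: "expansion \<Rightarrow> nat \<Rightarrow> real set" where
  "expansion_dom Adic s = {0..1}"
| "expansion_dom Nega s = {- (real s / (real s + 1))..1 / (real s + 1)}"

text \<open>
  The representation of a number with two expansions that is not used: here \<open>\<alpha> n\<close> plays the
  role of the lowered digit \<open>\<alpha>\<^sub>n - 1\<close>, so it must be less than \<open>s - 1\<close>. In particular the
  unique expansions of the end points of the domains, such as \<open>(s-1)(s-1)(s-1)\<dots>\<close> and
  \<open>0(s-1)0(s-1)\<dots>\<close>, are not excluded.
\<close>

fun unused_expansion :: "expansion \<Rightarrow> nat \<Rightarrow> (nat \<Rightarrow> nat) \<Rightarrow> bool" where
  "unused_expansion Adic s \<alpha> \<longleftrightarrow>
     (\<exists>n. \<alpha> n < s - 1 \<and> (\<forall>j. \<alpha> (Suc n + j) = s - 1))"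
| "unused_expansion Nega s \<alpha> \<longleftrightarrow>
     (\<exists>n. \<alpha> n < s - 1 \<and> (\<forall>j. \<alpha> (Suc n + j) = (if even j then 0 else s - 1)))"

definition words :: "nat \<Rightarrow> nat \<Rightarrow> nat list set" where
  "words s k = {w. set w \<subseteq> {..<s} \<and> length w = k}"

definition block :: "nat \<Rightarrow> (nat \<Rightarrow> nat) \<Rightarrow> nat \<Rightarrow> nat list" where
  "block k \<alpha> m = map \<alpha> [k * m..<k * Suc m]"

definition blockwise :: "nat \<Rightarrow> (nat list \<Rightarrow> nat list) \<Rightarrow> (nat \<Rightarrow> nat) \<Rightarrow> nat \<Rightarrow> nat" where
  "blockwise k \<theta> \<alpha> n = \<theta> (block k \<alpha> (n div k)) ! (n mod k)"

lemma block_in_words: "\<alpha> \<in> digit_seqs s \<Longrightarrow> block k \<alpha> m \<in> words s k"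
  by (auto simp: block_def words_def digit_seqs_def)

lemma block_blockwise:
  assumes "0 < k" "\<theta> ` words s k \<subseteq> words s k" "\<alpha> \<in> digit_seqs s"
  shows "block k (blockwise k \<theta> \<alpha>) m = \<theta> (block k \<alpha> m)"
proof (rule nth_equalityI)
  have "\<theta> (block k \<alpha> m) \<in> words s k"
    using assms block_in_words by blast
  then show len: "length (block k (blockwise k \<theta> \<alpha>) m) = length (\<theta> (block k \<alpha> m))"
    by (simp add: block_def words_def)
  fix i assume "i < length (block k (blockwise k \<theta> \<alpha>) m)"
  then have i: "i < k" by (simp add: block_def)
  then have "(k * m + i) div k = m" "(k * m + i) mod k = i"
    using assms(1) by simp_all
  then show "block k (blockwise k \<theta> \<alpha>) m ! i = \<theta> (block k \<alpha> m) ! i"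
    using i by (simp add: block_def blockwise_def)
qed

text \<open>
  Members are partial functions, so that each carries its own domain. Every point of
  \<open>expansion_dom e s\<close> has exactly one expansion that is not excluded, hence \<open>f\<close> is determined
  by \<open>e\<close>, \<open>e'\<close>, \<open>k\<close> and \<open>\<theta>\<close>.
\<close>

definition Lambda :: "nat \<Rightarrow> (real \<rightharpoonup> real) set" where
  "Lambda s = {f. \<exists>e e' k \<theta>.
     0 < k \<and> bij_betw \<theta> (words s k) (words s k) \<and>
     dom f = expansion_dom e s \<and>
     (\<forall>\<alpha> \<in> digit_seqs s. \<not> unused_expansion e s \<alpha> \<longrightarrow>
        f (expansion_val e s \<alpha>) = Some (expansion_val e' s (blockwise k \<theta> \<alpha>)))}"

end

theory Submission
  imports Defs
begin

text \<open>
  For the lower bound, the graph projects onto the domain of \<open>f\<close>, an interval of length \<open>1\<close>.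
  Projection does not enlarge diameters, so the intervals spanned by the projections of a cover
  have total length at least \<open>1\<close>; and \<open>d \<le> d powr t\<close> for \<open>0 < d \<le> 1\<close> and \<open>t \<le> 1\<close>. Hence the
  \<open>t\<close>-dimensional measure is at least \<open>1\<close> for every \<open>t \<le> 1\<close>
  (\<open>length_le_hausdorff_measure\<close>).

  For the upper bound, fix the first \<open>k * m\<close> digits of the argument. As they form \<open>m\<close> whole
  blocks, they determine the first \<open>k * m\<close> digits of the value, so the points of the graph with
  that prefix lie in a square of side \<open>1 / s ^ (k * m)\<close>, whichever kinds of expansion
  represent argument and value. There are \<open>s ^ (k * m)\<close> prefixes, and for \<open>t > 1\<close> the resulting
  bound on the covering sum, a constant times \<open>s ^ (k * m) * (1 / s ^ (k * m)) powr t\<close>, tends to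
  \<open>0\<close> (\<open>hausdorff_measure_graph_eq_0\<close>).

  These squares cover the graph because every point of the domain has an expansion that is not
  excluded (\<open>used_expansion_exists\<close>). An s-adic expansion is read off from \<open>\<lfloor>y * s ^ n\<rfloor>\<close>;
  replacing each digit in the positions with negative sign by its complement \<open>s - 1 - d\<close> turns
  it into a nega-s-adic expansion of a shifted number; and an excluded expansion is exchanged
  for the other expansion of the same number.
\<close>

section \<open>Estimates for Hausdorff measures\<close>

text \<open>
  Padding a finite cover with empty sets, which cost nothing, gives a cover indexed by the natural
  numbers. The case \<open>t = 0\<close> is left out: there a nonempty set costs \<open>1\<close>, but \<open>0 powr 0 = 0\<close>.
\<close>

lemma hausdorff_pre_measure_le_finite_cover:
  fixes E :: "'a::metric_space set"
  assumes fin: "finite I" and cover: "E \<subseteq> (\<Union>i\<in>I. C i)"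
    and small: "\<And>i x y. i \<in> I \<Longrightarrow> x \<in> C i \<Longrightarrow> y \<in> C i \<Longrightarrow> dist x y \<le> d"
    and d: "0 \<le> d" "d \<le> \<delta>" and t: "0 < t"
  shows "hausdorff_pre_measure t \<delta> E \<le> ennreal (real (card I) * d powr t)"
proof -
  obtain h where h: "bij_betw h {0..<card I} I"
    using ex_bij_betw_nat_finite[OF fin] by blast
  define U where "U n = (if n < card I then C (h n) else {})" for n
  have hI: "h n \<in> I" if "n < card I" for n
    using h that by (auto simp: bij_betw_def)
  have U_small: "dist x y \<le> d" if "x \<in> U n" "y \<in> U n" for x y n
    using that small[OF hI] by (auto simp: U_def split: if_splits)
  have U_bounded: "bounded (U n)" for n
    unfolding bounded_def using U_small by (cases "U n = {}") blast+
  have U_diam: "diameter (U n) \<le> d" for n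
    unfolding diameter_def using d U_small by (auto intro!: cSUP_least)
  have U_cover: "E \<subseteq> (\<Union>n. U n)"
  proof
    fix x assume "x \<in> E"
    then obtain i where i: "i \<in> I" "x \<in> C i" using cover by blast
    then obtain n where "n < card I" "h n = i"
      using bij_betw_imp_surj_on[OF h] by (metis atLeastLessThan_iff imageE)
    then show "x \<in> (\<Union>n. U n)" using i by (auto simp: U_def)
  qed
  have term_le: "diam_pow t (U n) \<le> ennreal (d powr t)" for n
    using t U_diam[of n] diameter_ge_0[OF U_bounded, of n]
    by (auto simp: diam_pow_def intro!: ennreal_leI powr_mono2)
  have "hausdorff_pre_measure t \<delta> E \<le> (\<Sum>n. diam_pow t (U n))"
    unfolding hausdorff_pre_measure_def
    using U_cover U_bounded U_diam d by (intro Inf_lower) (blast intro: order_trans)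
  also have "\<dots> = (\<Sum>n<card I. diam_pow t (U n))"
    by (rule suminf_finite) (auto simp: U_def diam_pow_def)
  also have "\<dots> \<le> (\<Sum>n<card I. ennreal (d powr t))"
    by (rule sum_mono) (rule term_le)
  also have "\<dots> = ennreal (real (card I) * d powr t)"
    by (simp add: ennreal_mult ennreal_of_nat_eq_real_of_nat)
  finally show ?thesis .
qed

lemma hausdorff_measure_eq_0I:
  fixes E :: "'a::metric_space set"
  assumes cover: "\<And>m. finite (I m)" "\<And>m. E \<subseteq> (\<Union>i\<in>I m. C m i)"
    and small: "\<And>m i x y. i \<in> I m \<Longrightarrow> x \<in> C m i \<Longrightarrow> y \<in> C m i \<Longrightarrow> dist x y \<le> d m"
    and d: "\<And>m. 0 \<le> d m" "d \<longlonglongrightarrow> 0" and t: "0 < t"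
    and cost: "(\<lambda>m. real (card (I m)) * d m powr t) \<longlonglongrightarrow> 0"
  shows "hausdorff_measure t E = 0"
proof -
  have "hausdorff_pre_measure t \<delta> E \<le> 0" if "\<delta> > 0" for \<delta>
  proof (rule tendsto_lowerbound)
    show "(\<lambda>m. ennreal (real (card (I m)) * d m powr t)) \<longlonglongrightarrow> 0"
      using tendsto_ennrealI[OF cost] by simp
    have "eventually (\<lambda>m. d m < \<delta>) sequentially"
      using order_tendstoD(2)[OF d(2) that] .
    then show "eventually (\<lambda>m. hausdorff_pre_measure t \<delta> E
        \<le> ennreal (real (card (I m)) * d m powr t)) sequentially"
    proof eventually_elim
      case (elim m)
      show ?case
        by (rule hausdorff_pre_measure_le_finite_cover[OF cover small d(1) _ t]) (use elim in auto)
    qed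
  qed simp
  then show ?thesis
    by (simp add: hausdorff_measure_def SUP_eq_const)
qed

text \<open>
  The intervals spanned by the projections of the covering sets cover \<open>{a..b}\<close>, so countable
  subadditivity of Lebesgue measure bounds \<open>b - a\<close> by the sum of the diameters. Covers with
  diameters at most \<open>1\<close> suffice, since the measure is a supremum over all scales; for them each
  diameter is at most its \<open>t\<close>-th power.
\<close>

lemma length_le_hausdorff_measure:
  fixes E :: "(real \<times> 'b::metric_space) set"
  assumes proj: "{a..b} \<subseteq> fst ` E" and ab: "a \<le> b" and t: "0 \<le> t" "t \<le> 1"
  shows "ennreal (b - a) \<le> hausdorff_measure t E"
proof -
  have "ennreal (b - a) \<le> (\<Sum>n. diam_pow t (U n))"
    if cover: "E \<subseteq> (\<Union>n. U n)" and bdd: "\<And>n. bounded (U n)"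
      and diam: "\<And>n. diameter (U n) \<le> 1" for U :: "nat \<Rightarrow> (real \<times> 'b) set"
  proof -
    define J where "J n = (if U n = {} then {} else {Inf (fst ` U n)..Sup (fst ` U n)})" for n
    have bdd_fst: "bdd_below (fst ` U n)" "bdd_above (fst ` U n)" for n
      using bounded_imp_bdd_below[OF bounded_fst[OF bdd]]
        bounded_imp_bdd_above[OF bounded_fst[OF bdd]] by auto
    have emeasure_J: "emeasure lborel (J n) \<le> diam_pow t (U n)" for n
    proof (cases "U n = {}")
      case False
      have gap: "fst p - fst q \<le> diameter (U n)" if "p \<in> U n" "q \<in> U n" for p q
      proof -
        have "fst p - fst q \<le> dist (fst p) (fst q)" by (simp add: dist_real_def)
        also have "\<dots> \<le> dist p q" by (rule dist_fst_le)
        also have "\<dots> \<le> diameter (U n)" using diameter_bounded_bound[OF bdd that] .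
        finally show ?thesis .
      qed
      have "Sup (fst ` U n) \<le> diameter (U n) + Inf (fst ` U n)"
      proof (rule cSUP_least[OF False])
        fix p assume p: "p \<in> U n"
        have "fst p - diameter (U n) \<le> Inf (fst ` U n)"
          by (rule cINF_greatest[OF False]) (use gap[OF p] in force)
        then show "fst p \<le> diameter (U n) + Inf (fst ` U n)" by simp
      qed
      moreover have "Inf (fst ` U n) \<le> Sup (fst ` U n)"
        using False bdd_fst by (intro cInf_le_cSup) auto
      ultimately have len: "emeasure lborel (J n) \<le> ennreal (diameter (U n))"
        using False by (auto simp: J_def intro!: ennreal_leI)
      (* A number in [0,1] does not decrease when raised to a power at most 1. *)
      have "diameter (U n) \<le> diameter (U n) powr t"
      proof (cases "diameter (U n) = 0")
        case False
        then have "diameter (U n) powr 1 \<le> diameter (U n) powr t"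
          using t diam[of n] diameter_ge_0[OF bdd, of n] by (intro powr_mono') auto
        then show ?thesis using diameter_ge_0[OF bdd, of n] by simp
      qed simp
      then show ?thesis
        using len False diam[of n]
        by (auto simp: diam_pow_def intro: order_trans ennreal_leI
            simp flip: ennreal_1)
    qed (simp add: J_def)
    have "{a..b} \<subseteq> (\<Union>n. J n)"
    proof
      fix x assume "x \<in> {a..b}"
      then obtain p where "p \<in> E" "x = fst p" using proj by blast
      then obtain n where "p \<in> U n" "x = fst p" using cover by blast
      then have "x \<in> J n"
        using bdd_fst[of n] by (auto simp: J_def intro: cINF_lower cSUP_upper)
      then show "x \<in> (\<Union>n. J n)" by blast
    qed
    then have "emeasure lborel {a..b} \<le> emeasure lborel (\<Union>n. J n)"
      by (intro emeasure_mono) (auto simp: J_def)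
    also have "\<dots> \<le> (\<Sum>n. emeasure lborel (J n))"
      by (rule emeasure_subadditive_countably) (auto simp: J_def)
    also have "\<dots> \<le> (\<Sum>n. diam_pow t (U n))"
      by (intro suminf_le emeasure_J) auto
    finally show ?thesis using ab by simp
  qed
  then have "ennreal (b - a) \<le> hausdorff_pre_measure t 1 E"
    unfolding hausdorff_pre_measure_def by (intro Inf_greatest) auto
  also have "\<dots> \<le> hausdorff_measure t E"
    unfolding hausdorff_measure_def by (rule SUP_upper) simp
  finally show ?thesis .
qed

section \<open>Signed digit series\<close>

text \<open>
  Both kinds of expansion are the series of the \<open>digit_sign e n * \<alpha> n / s ^ Suc n\<close>, which allows
  most facts to be proved for the two of them at once. The leading sign is negative for \<open>Nega\<close>.
\<close>

definition digit_sign :: "expansion \<Rightarrow> nat \<Rightarrow> real" where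
  "digit_sign e n = (case e of Adic \<Rightarrow> 1 | Nega \<Rightarrow> (- 1) ^ Suc n)"

lemma abs_digit_sign [simp]: "\<bar>digit_sign e n\<bar> = 1"
  by (cases e) (simp_all add: digit_sign_def power_abs)

text \<open>
  The largest contribution that digits from position \<open>N\<close> on can make. It controls both the size
  of a cylinder and the carry between two expansions of the same number.
\<close>

lemma top_digit_tail_sums:
  assumes s: "s > (1::nat)"
  shows "(\<lambda>n. if n < N then 0 else (real s - 1) / real s ^ Suc n) sums (1 / real s ^ N)"
proof -
  have "(\<lambda>i. (real s - 1) / real s ^ Suc N * (1 / real s) ^ i)
      sums ((real s - 1) / real s ^ Suc N * (1 / (1 - 1 / real s)))"
    using s by (intro sums_mult geometric_sums) simp
  also have "(real s - 1) / real s ^ Suc N * (1 / (1 - 1 / real s)) = 1 / real s ^ N"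
    using s by (simp add: field_simps)
  also have "(\<lambda>i. (real s - 1) / real s ^ Suc N * (1 / real s) ^ i)
      = (\<lambda>i. if i + N < N then 0 else (real s - 1) / real s ^ Suc (i + N))"
    by (auto simp: fun_eq_iff power_add power_divide)
  finally show ?thesis
    by (subst (asm) sums_iff_shift) simp
qed

lemma expansion_val_sums:
  assumes s: "s > 1" and \<alpha>: "\<alpha> \<in> digit_seqs s"
  shows "(\<lambda>n. digit_sign e n * real (\<alpha> n) / real s ^ Suc n) sums expansion_val e s \<alpha>"
proof -
  have "summable (\<lambda>n. digit_sign e n * real (\<alpha> n) / real s ^ Suc n)"
  proof (rule summable_comparison_test')
    show "summable (\<lambda>n. (real s - 1) / real s ^ Suc n)"
      using sums_summable[OF top_digit_tail_sums[OF s, of 0]] by simp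
    fix n
    have "\<alpha> n < s" using \<alpha> by (simp add: digit_seqs_def)
    then have "real (\<alpha> n) \<le> real s - 1" by linarith
    then show "norm (digit_sign e n * real (\<alpha> n) / real s ^ Suc n) \<le> (real s - 1) / real s ^ Suc n"
      by (simp add: abs_mult divide_right_mono)
  qed
  then show ?thesis
    by (cases e) (simp_all add: digit_sign_def summable_sums)
qed

lemma expansion_val_dist_le:
  assumes s: "s > 1" and \<alpha>: "\<alpha> \<in> digit_seqs s" and \<beta>: "\<beta> \<in> digit_seqs s"
    and agree: "\<And>n. n < N \<Longrightarrow> \<alpha> n = \<beta> n"
  shows "dist (expansion_val e s \<alpha>) (expansion_val e s \<beta>) \<le> 1 / real s ^ N"
proof -
  let ?D = "\<lambda>n. digit_sign e n * real (\<alpha> n) / real s ^ Suc n - digit_sign e n * real (\<beta> n) / real s ^ Suc n"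
  let ?T = "\<lambda>n. if n < N then 0 else (real s - 1) / real s ^ Suc n"
  have D: "?D sums (expansion_val e s \<alpha> - expansion_val e s \<beta>)"
    by (intro sums_diff expansion_val_sums s \<alpha> \<beta>)
  have T: "?T sums (1 / real s ^ N)" by (rule top_digit_tail_sums[OF s])
  have le: "\<bar>?D n\<bar> \<le> ?T n" for n
  proof (cases "n < N")
    case False
    have "\<alpha> n < s" "\<beta> n < s" using \<alpha> \<beta> by (auto simp: digit_seqs_def)
    then have "\<bar>real (\<alpha> n) - real (\<beta> n)\<bar> \<le> real s - 1" by linarith
    moreover have "?D n = digit_sign e n * (real (\<alpha> n) - real (\<beta> n)) / real s ^ Suc n"
      by (simp add: algebra_simps diff_divide_distrib)
    ultimately show ?thesis using False by (simp add: abs_mult divide_right_mono)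
  qed (simp add: agree)
  have "?D n \<le> ?T n" "- ?D n \<le> ?T n" for n using le[of n] by linarith+
  then have "expansion_val e s \<alpha> - expansion_val e s \<beta> \<le> 1 / real s ^ N"
    "- (expansion_val e s \<alpha> - expansion_val e s \<beta>) \<le> 1 / real s ^ N"
    using sums_le[OF _ D T] sums_le[OF _ sums_minus[OF D] T] by blast+
  then show ?thesis by (simp add: dist_real_def)
qed

section \<open>Existence of expansions\<close>

text \<open>
  The number \<open>1\<close> only has the expansion whose digits are all \<open>s - 1\<close>. For \<open>y < 1\<close> the digits are
  the last base-\<open>s\<close> digits of the integers \<open>\<lfloor>y * s ^ n\<rfloor>\<close>, so the partial sums of the series are
  the truncations of \<open>y\<close>.
\<close>

lemma adic_expansion_exists:
  assumes s: "s > (1::nat)" and y: "0 \<le> y" "y \<le> (1::real)"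
  shows "\<exists>\<gamma>\<in>digit_seqs s. (\<lambda>n. real (\<gamma> n) / real s ^ Suc n) sums y"
proof (cases "y = 1")
  case True
  have "(\<lambda>n. real (s - 1) / real s ^ Suc n) sums y"
    using top_digit_tail_sums[OF s, of 0] s True by (simp add: of_nat_diff)
  moreover have "(\<lambda>n. s - 1) \<in> digit_seqs s" using s by (simp add: digit_seqs_def)
  ultimately show ?thesis by (intro bexI[of _ "\<lambda>n. s - 1"])
next
  case False
  define F where "F n = \<lfloor>y * real s ^ n\<rfloor>" for n
  define \<gamma> where "\<gamma> n = nat (F (Suc n) mod int s)" for n
  have \<gamma>: "\<gamma> \<in> digit_seqs s" using s by (simp add: digit_seqs_def \<gamma>_def nat_less_iff)
  have real_\<gamma>: "real (\<gamma> n) = of_int (F (Suc n) mod int s)" for n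
    using s by (simp add: \<gamma>_def)
  have F_div: "F (Suc n) div int s = F n" for n
  proof -
    have "F (Suc n) div int s = \<lfloor>y * real s ^ Suc n / of_int (int s)\<rfloor>"
      unfolding F_def by (subst floor_divide_real_eq_div) auto
    then show ?thesis using s by (simp add: F_def)
  qed
  have F_Suc: "of_int (F (Suc n)) = real s * of_int (F n) + real (\<gamma> n)" for n
  proof -
    have "F (Suc n) = int s * F n + F (Suc n) mod int s"
      using mult_div_mod_eq[of "int s" "F (Suc n)"] by (simp add: F_div)
    then have "real_of_int (F (Suc n)) = of_int (int s * F n + F (Suc n) mod int s)" by simp
    then show ?thesis by (simp add: real_\<gamma>)
  qed
  have partial: "(\<Sum>n<N. real (\<gamma> n) / real s ^ Suc n) = of_int (F N) / real s ^ N" for N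
  proof (induction N)
    case 0
    show ?case using y False by (simp add: F_def floor_eq_iff)
  next
    case (Suc N)
    then show ?case using s by (simp add: F_Suc field_simps)
  qed
  have "(\<lambda>N. of_int (F N) / real s ^ N) \<longlonglongrightarrow> y"
  proof (rule tendsto_sandwich[of "\<lambda>N. y - (1 / real s) ^ N" _ _ "\<lambda>N. y"])
    have "(\<lambda>N. (1 / real s) ^ N) \<longlonglongrightarrow> 0" using s by (intro LIMSEQ_realpow_zero) auto
    then show "(\<lambda>N. y - (1 / real s) ^ N) \<longlonglongrightarrow> y"
      using tendsto_diff[OF tendsto_const, of _ 0 sequentially y] by simp
    have "y * real s ^ N - 1 \<le> of_int (F N)" "of_int (F N) \<le> y * real s ^ N" for N
      unfolding F_def by linarith+
    then have "(y * real s ^ N - 1) / real s ^ N \<le> of_int (F N) / real s ^ N"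
      "of_int (F N) / real s ^ N \<le> y * real s ^ N / real s ^ N" for N
      by (intro divide_right_mono; simp)+
    then show "\<forall>\<^sub>F N in sequentially. y - (1 / real s) ^ N \<le> of_int (F N) / real s ^ N"
      "\<forall>\<^sub>F N in sequentially. of_int (F N) / real s ^ N \<le> y"
      using s by (simp_all add: diff_divide_distrib power_one_over)
  qed simp
  then have "(\<lambda>n. real (\<gamma> n) / real s ^ Suc n) sums y"
    unfolding sums_def partial .
  then show ?thesis using \<gamma> by blast
qed

text \<open>
  The absolute value of the least nega-s-adic number, whose digits are \<open>s - 1\<close> in the positions
  with negative sign and \<open>0\<close> elsewhere. The factor \<open>(1 + (- 1) ^ n) / 2\<close> selects the even
  positions and splits the series into two geometric ones.
\<close>

lemma even_top_digits_sums:
  assumes s: "s > (1::nat)"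
  shows "(\<lambda>n. (real s - 1) * ((1 + (- 1) ^ n) / 2) / real s ^ Suc n) sums (real s / (real s + 1))"
proof -
  have "(\<lambda>n. (real s - 1) / (2 * real s) * ((1 / real s) ^ n + (- 1 / real s) ^ n))
     sums ((real s - 1) / (2 * real s) * (1 / (1 - 1 / real s) + 1 / (1 - (- 1 / real s))))"
    using s by (intro sums_mult sums_add geometric_sums) auto
  also have "(real s - 1) / (2 * real s) * (1 / (1 - 1 / real s) + 1 / (1 - (- 1 / real s)))
      = real s / (real s + 1)"
  proof -
    have "1 / (1 - 1 / real s) = real s / (real s - 1)"
      "1 / (1 - (- 1 / real s)) = real s / (real s + 1)"
      using s by (simp_all add: field_simps)
    moreover have "real s - 1 > 0" "real s + 1 > 0" "real s > 0" using s by auto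
    ultimately show ?thesis by (simp add: divide_simps) (simp add: algebra_simps)
  qed
  also have "(\<lambda>n. (real s - 1) / (2 * real s) * ((1 / real s) ^ n + (- 1 / real s) ^ n))
      = (\<lambda>n. (real s - 1) * ((1 + (- 1) ^ n) / 2) / real s ^ Suc n)"
  proof
    fix n
    have "(- 1 / real s) ^ n = (- 1) ^ n / real s ^ n" by (rule power_divide)
    then show "(real s - 1) / (2 * real s) * ((1 / real s) ^ n + (- 1 / real s) ^ n)
        = (real s - 1) * ((1 + (- 1) ^ n) / 2) / real s ^ Suc n"
      by (simp add: power_one_over add_divide_distrib algebra_simps)
  qed
  finally show ?thesis .
qed

text \<open>
  In a position with negative sign, \<open>- (s - 1 - d) = d - (s - 1)\<close>. Complementing the digits there
  therefore turns an s-adic expansion of \<open>x + s / (s + 1)\<close> into a nega-s-adic expansion of \<open>x\<close>.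
\<close>

lemma expansion_exists:
  assumes s: "s > 1" and x: "x \<in> expansion_dom e s"
  shows "\<exists>\<alpha>\<in>digit_seqs s. expansion_val e s \<alpha> = x"
proof (cases e)
  case Adic
  then obtain \<alpha> where "\<alpha> \<in> digit_seqs s" "(\<lambda>n. real (\<alpha> n) / real s ^ Suc n) sums x"
    using adic_expansion_exists[OF s, of x] x by auto
  then show ?thesis using Adic by (auto simp: sums_iff)
next
  case Nega
  have "0 \<le> x + real s / (real s + 1)" "x + real s / (real s + 1) \<le> 1 / (real s + 1) + real s / (real s + 1)"
    using x Nega by auto
  moreover have "1 / (real s + 1) + real s / (real s + 1) = 1"
    by (simp add: divide_simps)
  ultimately obtain \<gamma> where \<gamma>: "\<gamma> \<in> digit_seqs s"
    and sums: "(\<lambda>n. real (\<gamma> n) / real s ^ Suc n) sums (x + real s / (real s + 1))"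
    using adic_expansion_exists[OF s, of "x + real s / (real s + 1)"] by auto
  define \<alpha> where "\<alpha> n = (if even n then s - 1 - \<gamma> n else \<gamma> n)" for n
  have less: "\<gamma> n < s" for n using \<gamma> by (simp add: digit_seqs_def)
  have \<alpha>: "\<alpha> \<in> digit_seqs s" using less s by (auto simp: digit_seqs_def \<alpha>_def)
  have "(\<lambda>n. real (\<gamma> n) / real s ^ Suc n - (real s - 1) * ((1 + (- 1) ^ n) / 2) / real s ^ Suc n)
      sums (x + real s / (real s + 1) - real s / (real s + 1))"
    by (intro sums_diff sums even_top_digits_sums s)
  moreover have "real (\<gamma> n) / real s ^ Suc n - (real s - 1) * ((1 + (- 1) ^ n) / 2) / real s ^ Suc n
      = (- 1) ^ Suc n * real (\<alpha> n) / real s ^ Suc n" for n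
  proof -
    have "real (\<gamma> n) - (real s - 1) * ((1 + (- 1) ^ n) / 2) = (- 1) ^ Suc n * real (\<alpha> n)"
    proof (cases "even n")
      case True
      have "real (s - 1 - \<gamma> n) = real s - 1 - real (\<gamma> n)" using less[of n] by linarith
      then show ?thesis using True by (simp add: \<alpha>_def)
    qed (simp add: \<alpha>_def)
    then show ?thesis by (simp only: diff_divide_distrib[symmetric])
  qed
  ultimately have "(\<lambda>n. (- 1) ^ Suc n * real (\<alpha> n) / real s ^ Suc n) sums x" by simp
  then have "expansion_val e s \<alpha> = x" using Nega by (simp add: sums_iff)
  then show ?thesis using \<alpha> by blast
qed

text \<open>
  Raising digit \<open>n\<close> by one is compensated by a tail in which every term changes by the maximal
  amount \<open>s - 1\<close> in the opposite direction. This is the identity behind numbers with two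
  expansions, in both kinds of expansion.
\<close>

lemma carry_preserves_expansion_val:
  assumes s: "s > 1" and \<alpha>: "\<alpha> \<in> digit_seqs s" and \<beta>: "\<beta> \<in> digit_seqs s"
    and agree: "\<And>i. i < n \<Longrightarrow> \<beta> i = \<alpha> i" and carry: "\<beta> n = Suc (\<alpha> n)"
    and tail: "\<And>i. n < i \<Longrightarrow>
      digit_sign e i * (real (\<alpha> i) - real (\<beta> i)) = digit_sign e n * (real s - 1)"
  shows "expansion_val e s \<beta> = expansion_val e s \<alpha>"
proof -
  let ?D = "\<lambda>i. digit_sign e i * real (\<alpha> i) / real s ^ Suc i - digit_sign e i * real (\<beta> i) / real s ^ Suc i"
  let ?T = "\<lambda>i. if i < Suc n then 0 else (real s - 1) / real s ^ Suc i"
  let ?G = "\<lambda>i. digit_sign e n * (?T i - (if i = n then 1 / real s ^ Suc n else 0))"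
  have D: "?D sums (expansion_val e s \<alpha> - expansion_val e s \<beta>)"
    by (intro sums_diff expansion_val_sums s \<alpha> \<beta>)
  have G: "?G sums (digit_sign e n * (1 / real s ^ Suc n - 1 / real s ^ Suc n))"
    using sums_single[of n "\<lambda>_. 1 / real s ^ Suc n"]
    by (intro sums_mult sums_diff top_digit_tail_sums s) (simp add: eq_commute)
  have D_eq_G: "?D i = ?G i" for i
  proof -
    consider "i < n" | "i = n" | "n < i" by linarith
    then show ?thesis
    proof cases
      case 1
      then show ?thesis by (simp add: agree)
    next
      case 2
      then show ?thesis by (simp add: carry algebra_simps add_divide_distrib)
    next
      case 3
      have "?D i = digit_sign e i * (real (\<alpha> i) - real (\<beta> i)) / real s ^ Suc i"
        by (simp add: algebra_simps diff_divide_distrib)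
      then show ?thesis using 3 by (simp add: tail)
    qed
  qed
  have "?D = ?G" by (rule ext) (rule D_eq_G)
  then have "expansion_val e s \<alpha> - expansion_val e s \<beta> = 0"
    using sums_unique2[OF D] G by simp
  then show ?thesis by simp
qed

text \<open>
  A common form of the two exclusion rules: the tail is \<open>(s-1)(s-1)\<dots>\<close> for \<open>Adic\<close> and
  \<open>0(s-1)0(s-1)\<dots>\<close> for \<open>Nega\<close>.
\<close>

lemma unused_expansion_iff:
  "unused_expansion e s \<alpha> \<longleftrightarrow>
     (\<exists>n. \<alpha> n < s - 1 \<and> (\<forall>j. \<alpha> (Suc n + j) = (if e = Nega \<and> even j then 0 else s - 1)))"
  by (cases e) simp_all

text \<open>
  In both cases the other expansion of the number arises from an excluded one by raising the
  lowered digit and complementing all later digits. It is not excluded itself: for \<open>Adic\<close> it ends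
  in zeros, and for \<open>Nega\<close> its tail is \<open>(s-1)0(s-1)0\<dots>\<close> and comes after a nonzero digit.
\<close>

lemma used_expansion_exists:
  assumes s: "s > 1" and x: "x \<in> expansion_dom e s"
  shows "\<exists>\<alpha>\<in>digit_seqs s. \<not> unused_expansion e s \<alpha> \<and> expansion_val e s \<alpha> = x"
proof -
  obtain \<alpha> where \<alpha>: "\<alpha> \<in> digit_seqs s" and val: "expansion_val e s \<alpha> = x"
    using expansion_exists[OF s x] by blast
  show ?thesis
  proof (cases "unused_expansion e s \<alpha>")
    case False
    then show ?thesis using \<alpha> val by blast
  next
    case True
    then obtain n where n: "\<alpha> n < s - 1"
      and tail: "\<And>j. \<alpha> (Suc n + j) = (if e = Nega \<and> even j then 0 else s - 1)"
      unfolding unused_expansion_iff by blast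
    define \<beta> where "\<beta> i = (if i < n then \<alpha> i else if i = n then Suc (\<alpha> n) else s - 1 - \<alpha> i)" for i
    have less: "\<alpha> i < s" for i using \<alpha> by (simp add: digit_seqs_def)
    have \<beta>: "\<beta> \<in> digit_seqs s"
      using less n s by (auto simp: digit_seqs_def \<beta>_def)
    have \<beta>_tail: "\<beta> (Suc n + j) = (if e = Nega \<and> even j then s - 1 else 0)" for j
      using s by (simp add: \<beta>_def tail[of j, simplified])
    have "expansion_val e s \<beta> = expansion_val e s \<alpha>"
    proof (rule carry_preserves_expansion_val[OF s \<alpha> \<beta>, of n])
      fix i assume "n < i"
      then obtain j where j: "i = Suc n + j" using less_iff_Suc_add by auto
      show "digit_sign e i * (real (\<alpha> i) - real (\<beta> i)) = digit_sign e n * (real s - 1)"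
        unfolding j tail \<beta>_tail using s
        by (cases e) (auto simp: digit_sign_def of_nat_diff power_add algebra_simps)
    qed (simp_all add: \<beta>_def)
    moreover have "\<not> unused_expansion e s \<beta>"
    proof
      assume "unused_expansion e s \<beta>"
      then obtain n' where n': "\<beta> n' < s - 1"
        and tail': "\<And>j. \<beta> (Suc n' + j) = (if e = Nega \<and> even j then 0 else s - 1)"
        unfolding unused_expansion_iff by blast
      show False
      proof (cases e)
        case Adic
        then have "\<beta> (Suc n + n') = 0" "\<beta> (Suc n' + n) = s - 1"
          using \<beta>_tail[of n'] tail'[of n] by simp_all
        moreover have "Suc n + n' = Suc n' + n" by simp
        ultimately show False using s by (metis zero_less_diff less_numeral_extra(3))
      next
        case Nega
        (* An excluded tail after n' starts with 0 and alternates. For n' < n the nonzero digit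
           at n fixes its parity and forces a 0 at Suc n. For n' = n its first digit is at Suc n.
           For n < n' the digit at n' is 0, so the next one is s - 1. *)
        consider "n' < n" | "n' = n" | "n < n'" by linarith
        then show False
        proof cases
          case 1
          then obtain j where j: "n = Suc n' + j" using less_iff_Suc_add by auto
          have "\<beta> n \<noteq> 0" by (simp add: \<beta>_def)
          then have "odd j" using tail'[of j] j Nega by auto
          then have "\<beta> (Suc n) = 0" using tail'[of "Suc j"] j Nega by simp
          then show False using \<beta>_tail[of 0] Nega s by simp
        next
          case 2
          then show False using tail'[of 0] \<beta>_tail[of 0] Nega s by simp
        next
          case 3
          then obtain j where j: "n' = Suc n + j" using less_iff_Suc_add by auto
          have "odd j" using n' \<beta>_tail[of j] j Nega by auto
          then have "\<beta> (Suc n') = s - 1" using \<beta>_tail[of "Suc j"] j Nega by simp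
          then show False using tail'[of 0] Nega s by simp
        qed
      qed
    qed
    ultimately show ?thesis using \<beta> val by auto
  qed
qed

section \<open>Dimension of graphs of blockwise digit substitutions\<close>

lemma blockwise_in_digit_seqs:
  assumes "0 < k" "\<theta> ` words s k \<subseteq> words s k" "\<alpha> \<in> digit_seqs s"
  shows "blockwise k \<theta> \<alpha> \<in> digit_seqs s"
proof -
  have "blockwise k \<theta> \<alpha> n < s" for n
  proof -
    have "\<theta> (block k \<alpha> (n div k)) \<in> words s k" using assms block_in_words by blast
    then have "set (\<theta> (block k \<alpha> (n div k))) \<subseteq> {..<s}" "n mod k < length (\<theta> (block k \<alpha> (n div k)))"
      using assms(1) by (auto simp: words_def)
    then show ?thesis unfolding blockwise_def using nth_mem by blast
  qed
  then show ?thesis by (simp add: digit_seqs_def)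
qed

text \<open>
  Whole blocks of the argument determine the corresponding blocks of the value. This is why the
  cylinders below are taken at lengths divisible by \<open>k\<close>.
\<close>

lemma blockwise_cong_prefix:
  assumes "\<And>i. i < k * m \<Longrightarrow> \<alpha> i = \<beta> i" and "n < k * m"
  shows "blockwise k \<theta> \<alpha> n = blockwise k \<theta> \<beta> n"
proof -
  have "n div k < m" using assms(2) by (simp add: less_mult_imp_div_less mult.commute)
  then have "k * Suc (n div k) \<le> k * m" by (intro mult_le_mono2) simp
  then have "block k \<alpha> (n div k) = block k \<beta> (n div k)"
    unfolding block_def by (intro map_cong refl assms(1)) (auto simp del: mult_Suc_right intro: less_le_trans)
  then show ?thesis by (simp add: blockwise_def)
qed

text \<open>
  The graph is covered by its cylinders of \<open>k * m\<close> digits, one for each word of that length. A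
  cylinder has width and height at most \<open>1 / s ^ (k * m)\<close>, and \<open>t > 1\<close> beats the number of words.
\<close>

lemma hausdorff_measure_graph_eq_0:
  assumes s: "s > 1" and k: "0 < k" and \<theta>: "\<theta> ` words s k \<subseteq> words s k"
    and dom_f: "dom f = expansion_dom e s"
    and f: "\<And>\<alpha>. \<alpha> \<in> digit_seqs s \<Longrightarrow> \<not> unused_expansion e s \<alpha> \<Longrightarrow>
        f (expansion_val e s \<alpha>) = Some (expansion_val e' s (blockwise k \<theta> \<alpha>))"
    and t: "t > 1"
  shows "hausdorff_measure t (Map.graph f) = 0"
proof -
  define pt where "pt \<alpha> = (expansion_val e s \<alpha>, expansion_val e' s (blockwise k \<theta> \<alpha>))" for \<alpha>
  define C where "C m w = {pt \<alpha> |\<alpha>. \<alpha> \<in> digit_seqs s \<and> map \<alpha> [0..<k * m] = w}" for m w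
  define d where "d m = 2 * (1 / real s ^ (k * m))" for m
  show ?thesis
  proof (rule hausdorff_measure_eq_0I[of "\<lambda>m. words s (k * m)" _ C d])
    show "finite (words s (k * m))" for m
      unfolding words_def by (rule finite_lists_length_eq) simp
    show "Map.graph f \<subseteq> (\<Union>w\<in>words s (k * m). C m w)" for m
    proof
      fix p assume "p \<in> Map.graph f"
      then obtain x y where p: "p = (x, y)" "f x = Some y" by (auto simp: Map.graph_def)
      then have "x \<in> expansion_dom e s" using dom_f by blast
      then obtain \<alpha> where \<alpha>: "\<alpha> \<in> digit_seqs s" "\<not> unused_expansion e s \<alpha>" "expansion_val e s \<alpha> = x"
        using used_expansion_exists[OF s] by blast
      then have "p = pt \<alpha>" using f[of \<alpha>] p by (simp add: pt_def)
      moreover have "map \<alpha> [0..<k * m] \<in> words s (k * m)"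
        using \<alpha>(1) by (auto simp: words_def digit_seqs_def)
      ultimately show "p \<in> (\<Union>w\<in>words s (k * m). C m w)"
        using \<alpha>(1) by (auto simp: C_def)
    qed
    show "dist p q \<le> d m" if "p \<in> C m w" "q \<in> C m w" for m w p q
    proof -
      from that obtain \<alpha> \<beta> where \<alpha>: "\<alpha> \<in> digit_seqs s" "p = pt \<alpha>" and \<beta>: "\<beta> \<in> digit_seqs s" "q = pt \<beta>"
        and "map \<alpha> [0..<k * m] = map \<beta> [0..<k * m]"
        by (auto simp: C_def)
      then have agree: "\<alpha> i = \<beta> i" if "i < k * m" for i using that by simp
      have "dist (fst p) (fst q) \<le> 1 / real s ^ (k * m)"
        unfolding \<alpha> \<beta> pt_def fst_conv
        by (rule expansion_val_dist_le[OF s \<alpha>(1) \<beta>(1) agree])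
      moreover have "dist (snd p) (snd q) \<le> 1 / real s ^ (k * m)"
        unfolding \<alpha> \<beta> pt_def snd_conv
        by (rule expansion_val_dist_le[OF s blockwise_in_digit_seqs[OF k \<theta> \<alpha>(1)]
              blockwise_in_digit_seqs[OF k \<theta> \<beta>(1)] blockwise_cong_prefix[OF agree]])
      moreover have "dist p q \<le> dist (fst p) (fst q) + dist (snd p) (snd q)"
        unfolding dist_prod_def by (rule sqrt_sum_squares_le_sum) auto
      ultimately show ?thesis by (simp add: d_def)
    qed
    show "0 \<le> d m" for m by (simp add: d_def)
    have q: "0 < (1 / real s) ^ k" "(1 / real s) ^ k < 1"
      using s k by (auto simp: power_less_one_iff)
    have d_eq: "d = (\<lambda>m. 2 * ((1 / real s) ^ k) ^ m)"
      by (auto simp: d_def fun_eq_iff power_mult[symmetric] power_divide)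
    have "(\<lambda>m. 2 * ((1 / real s) ^ k) ^ m) \<longlonglongrightarrow> 2 * 0"
      using q by (intro tendsto_mult tendsto_const LIMSEQ_realpow_zero) auto
    then show "d \<longlonglongrightarrow> 0" by (simp add: d_eq)
    show "0 < t" using t by simp
    have card: "card (words s n) = s ^ n" for n
      unfolding words_def by (subst card_lists_length_eq) auto
    have "real (card (words s (k * m))) * d m powr t = 2 powr t * (((1 / real s) ^ k) powr (t - 1)) ^ m" for m
    proof -
      define Q where "Q = real s ^ (k * m)"
      have Q: "Q > 0" using s by (simp add: Q_def)
      have "real (card (words s (k * m))) * d m powr t = 2 powr t * (Q * (1 / Q) powr t)"
        using powr_mult[of 2 "1 / Q" t] by (simp add: card d_def flip: Q_def)
      also have "Q * (1 / Q) powr t = (1 / Q) powr (t - 1)"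
        using Q by (simp add: powr_diff)
      also have "1 / Q = ((1 / real s) ^ k) ^ m"
        by (simp add: Q_def power_mult power_divide)
      also have "\<dots> powr (t - 1) = (((1 / real s) ^ k) powr (t - 1)) ^ m"
        using q(1) by (induction m) (simp_all add: powr_mult)
      finally show ?thesis .
    qed
    moreover have less: "((1 / real s) ^ k) powr (t - 1) < 1"
      using powr_less_mono2[of "t - 1" "(1 / real s) ^ k" 1] q t by simp
    moreover have "(\<lambda>m. 2 powr t * (((1 / real s) ^ k) powr (t - 1)) ^ m) \<longlonglongrightarrow> 2 powr t * 0"
      using less by (intro tendsto_mult tendsto_const LIMSEQ_realpow_zero) simp_all
    ultimately show "(\<lambda>m. real (card (words s (k * m))) * d m powr t) \<longlonglongrightarrow> 0" by simp
  qed
qed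

theorem theorem3:
  fixes s :: nat and f :: "real \<rightharpoonup> real"
  assumes "s > 1" and "f \<in> Lambda s"
  shows "hausdorff_dim (Map.graph f) = 1"
proof -
  from assms(2) obtain e e' k \<theta> where k: "0 < k"
    and \<theta>: "bij_betw \<theta> (words s k) (words s k)"
    and dom_f: "dom f = expansion_dom e s"
    and f: "\<And>\<alpha>. \<alpha> \<in> digit_seqs s \<Longrightarrow> \<not> unused_expansion e s \<alpha> \<Longrightarrow>
        f (expansion_val e s \<alpha>) = Some (expansion_val e' s (blockwise k \<theta> \<alpha>))"
    unfolding Lambda_def by blast
  have upper: "hausdorff_measure t (Map.graph f) = 0" if "t > 1" for t
    using hausdorff_measure_graph_eq_0[OF assms(1) k _ dom_f f that] \<theta>
    by (simp add: bij_betw_def)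
  obtain a b :: real where ab: "expansion_dom e s = {a..b}" "b - a = 1"
  proof (cases e)
    case Adic
    show ?thesis by (rule that[of 0 1]) (simp_all add: Adic)
  next
    case Nega
    show ?thesis
      by (rule that[of "- (real s / (real s + 1))" "1 / (real s + 1)"])
        (simp_all add: Nega divide_simps)
  qed
  have "fst ` Map.graph f = {a..b}"
    using dom_f ab by (simp add: fst_graph_eq_dom)
  then have lower: "hausdorff_measure t (Map.graph f) \<noteq> 0" if "0 \<le> t" "t \<le> 1" for t
    using length_le_hausdorff_measure[of a b "Map.graph f" t] that ab(2) by auto
  show ?thesis
  proof (rule antisym)
    show "1 \<le> hausdorff_dim (Map.graph f)"
      unfolding hausdorff_dim_def
    proof (rule Inf_greatest, clarify)
      fix t :: real assume "0 \<le> t" "hausdorff_measure t (Map.graph f) = 0"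
      then have "1 \<le> t" using lower[of t] by linarith
      then show "1 \<le> ennreal t" using ennreal_leI[of 1 t] by simp
    qed
    have "hausdorff_dim (Map.graph f) \<le> ennreal (1 + \<epsilon>)" if "\<epsilon> > 0" for \<epsilon>
      unfolding hausdorff_dim_def
      by (rule Inf_lower) (use upper[of "1 + \<epsilon>"] that in \<open>auto intro!: exI[of _ "1 + \<epsilon>"]\<close>)
    moreover have "ennreal (1 + \<epsilon>) = 1 + ennreal \<epsilon>" if "\<epsilon> > 0" for \<epsilon>
      using that by (simp add: ennreal_plus)
    ultimately show "hausdorff_dim (Map.graph f) \<le> 1"
      by (metis ennreal_le_epsilon)
  qed
qed

end
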